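(* Let $G$ be a group with a left-invariant total order $<$ (i.e. $h < h' \iff gh < gh'$ for all $g,h,h' \in G$), and let $S \subset G$ be a finite set in good position, i.e. $1_G \in S$ and $1_G$ is the $<$-maximal element of $S$. Let $\mathcal{C}$ be an $S$-UCP convexoid on $G$, $A$ a finite nonempty alphabet and $k \ge 1$. Let $X = \{x \in A^G : \forall g \in G,\ (gx)|_S \in \mathcal{T}\}$ be defined by a $k$-TEP family $\mathcal{T} \subset A^S$ (with respect to $\mathcal{C}$), and suppose $\mathcal{T}$ also has $k$-uniform $\{1_G\}$-extensions. Let $C \in \mathcal{C}$ and let $E = \{g \in C : gS \not\subset C\}$ be the $S$-contour of $C$. Then for each pattern $P : E \to A$, there are exactly $k^{|C| - |E|}$ patterns $Q : C \to A$ with $Q|_E = P$ such that $Q = x|_C$ for some $x \in X$.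
   Context: Action: $(gx)_h = x_{g^{-1}h}$ for $x \in A^G$. Convexoid: a family $\mathcal{C}$ of finite subsets of $G$ such that $\emptyset \in \mathcal{C}$, every finite subset of $G$ is contained in some element of $\mathcal{C}$, and whenever $C, D \in \mathcal{C}$ with $C \subsetneq D$ there is $a \in D \setminus C$ with $C \cup \{a\} \in \mathcal{C}$. For finite $B \subset G$ put $\overline{B} = \bigcap\{C \in \mathcal{C} : B \subset C\}$; the lax corners of $B$ are $\angle B = \{a \in B : a \notin \overline{B \setminus \{a\}}\}$. The convexoid is $S$-UCP if for all $C \in \mathcal{C}$ and $a \in \angle C$ there is at most one $g \in G$ with $a \in gS \subset C$. $k$-TEP: for $\emptyset \neq E' \subset S$, $\mathcal{T} \subset A^S$ has $k$-uniform $E'$-extensions if for every $s \in E'$ and every $P \in A^{S \setminus \{s\}}$ there are exactly $k$ symbols $a \in A$ such that the extension of $P$ to $S$ with value $a$ at $s$ lies in $\mathcal{T}$. $\mathcal{T}$ is $k$-TEP if for every $g \in G$ it has $k$-uniform $(g^{-1}\angle(gS))$-extensions. *)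

theory Defs
  imports "HOL-Algebra.Coset" "HOL-Library.FuncSet"
begin

text \<open>
  Configurations and patterns over an alphabet \<open>A\<close> are extensional functions: \<open>A\<^sup>D\<close> is
  \<open>D \<rightarrow>\<^sub>E A\<close> and the restriction of \<open>x\<close> to \<open>D\<close> is \<open>restrict x D\<close>. The translate \<open>gS\<close> of an
  arbitrary set \<open>S\<close> of group elements is \<open>g <#\<^bsub>G\<^esub> S\<close>.
\<close>

definition shift_action :: "('g, 'm) monoid_scheme \<Rightarrow> 'g \<Rightarrow> ('g \<Rightarrow> 'a) \<Rightarrow> 'g \<Rightarrow> 'a" where
  "shift_action G g x = (\<lambda>h\<in>carrier G. x (inv\<^bsub>G\<^esub> g \<otimes>\<^bsub>G\<^esub> h))"

definition subshift ::
  "('g, 'm) monoid_scheme \<Rightarrow> 'a set \<Rightarrow> 'g set \<Rightarrow> ('g \<Rightarrow> 'a) set \<Rightarrow> ('g \<Rightarrow> 'a) set" where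
  "subshift G A S T =
    {x \<in> carrier G \<rightarrow>\<^sub>E A. \<forall>g\<in>carrier G. restrict (shift_action G g x) S \<in> T}"

definition left_invariant :: "('g, 'm) monoid_scheme \<Rightarrow> 'g rel \<Rightarrow> bool" where
  "left_invariant G r \<longleftrightarrow>
    (\<forall>g\<in>carrier G. \<forall>h\<in>carrier G. \<forall>h'\<in>carrier G.
      (h, h') \<in> r \<longleftrightarrow> (g \<otimes>\<^bsub>G\<^esub> h, g \<otimes>\<^bsub>G\<^esub> h') \<in> r)"

text \<open>Here \<open>r\<close> is a strict order: \<open>(h, h') \<in> r\<close> means \<open>h < h'\<close>.\<close>

definition good_position :: "('g, 'm) monoid_scheme \<Rightarrow> 'g rel \<Rightarrow> 'g set \<Rightarrow> bool" where
  "good_position G r S \<longleftrightarrow> \<one>\<^bsub>G\<^esub> \<in> S \<and> (\<forall>s\<in>S. s \<noteq> \<one>\<^bsub>G\<^esub> \<longrightarrow> (s, \<one>\<^bsub>G\<^esub>) \<in> r)"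

definition convexoid :: "'g set \<Rightarrow> 'g set set \<Rightarrow> bool" where
  "convexoid V \<C> \<longleftrightarrow>
    (\<forall>C\<in>\<C>. finite C \<and> C \<subseteq> V) \<and>
    {} \<in> \<C> \<and>
    (\<forall>F. finite F \<and> F \<subseteq> V \<longrightarrow> (\<exists>C\<in>\<C>. F \<subseteq> C)) \<and>
    (\<forall>C\<in>\<C>. \<forall>D\<in>\<C>. C \<subset> D \<longrightarrow> (\<exists>a\<in>D - C. C \<union> {a} \<in> \<C>))"

definition convexoid_closure :: "'g set set \<Rightarrow> 'g set \<Rightarrow> 'g set" where
  "convexoid_closure \<C> B = \<Inter>{C \<in> \<C>. B \<subseteq> C}"

definition lax_corners :: "'g set set \<Rightarrow> 'g set \<Rightarrow> 'g set" where
  "lax_corners \<C> B = {a \<in> B. a \<notin> convexoid_closure \<C> (B - {a})}"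

definition S_UCP :: "('g, 'm) monoid_scheme \<Rightarrow> 'g set \<Rightarrow> 'g set set \<Rightarrow> bool" where
  "S_UCP G S \<C> \<longleftrightarrow>
    (\<forall>C\<in>\<C>. \<forall>a\<in>lax_corners \<C> C.
      \<exists>\<^sub>\<le>\<^sub>1 g. g \<in> carrier G \<and> a \<in> g <#\<^bsub>G\<^esub> S \<and> g <#\<^bsub>G\<^esub> S \<subseteq> C)"

definition uniform_extensions ::
  "'a set \<Rightarrow> 'g set \<Rightarrow> ('g \<Rightarrow> 'a) set \<Rightarrow> nat \<Rightarrow> 'g set \<Rightarrow> bool" where
  "uniform_extensions A S T k E' \<longleftrightarrow>
    E' \<noteq> {} \<and> E' \<subseteq> S \<and>
    (\<forall>s\<in>E'. \<forall>P\<in>(S - {s}) \<rightarrow>\<^sub>E A. card {a \<in> A. P(s := a) \<in> T} = k)"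

text \<open>
  In a convexoid every finite nonempty set has a lax corner, so for finite nonempty \<open>S\<close> the side
  conditions \<open>E' \<noteq> {}\<close> and \<open>E' \<subseteq> S\<close> hold automatically for the sets used next.
\<close>

definition TEP ::
  "('g, 'm) monoid_scheme \<Rightarrow> 'g set set \<Rightarrow> 'a set \<Rightarrow> 'g set \<Rightarrow> ('g \<Rightarrow> 'a) set \<Rightarrow> nat \<Rightarrow> bool" where
  "TEP G \<C> A S T k \<longleftrightarrow>
    (\<forall>g\<in>carrier G.
      uniform_extensions A S T k (inv\<^bsub>G\<^esub> g <#\<^bsub>G\<^esub> lax_corners \<C> (g <#\<^bsub>G\<^esub> S)))"

definition contour :: "('g, 'm) monoid_scheme \<Rightarrow> 'g set \<Rightarrow> 'g set \<Rightarrow> 'g set" where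
  "contour G S C = {g \<in> C. \<not> g <#\<^bsub>G\<^esub> S \<subseteq> C}"

end

theory Submission
  imports Defs "HOL-Analysis.Function_Topology"
begin

text \<open>
  Call a pattern on \<open>C\<close> locally valid if it satisfies the constraint \<open>T\<close> on every translate of \<open>S\<close>
  contained in \<open>C\<close>. Two independent facts give the count.

  Every locally valid pattern on a member \<open>C\<close> of the family is the restriction of a point of the
  subshift (\<open>locally_valid_iff_extends_to_subshift\<close>). A larger member \<open>D\<close> is reached from \<open>C\<close> by
  adding one point \<open>a\<close> at a time. Each new point is a lax corner of the enlarged set, so by the
  unique corner property at most one translate \<open>g S\<close> creates a new constraint. The point \<open>a\<close> is
  then also a lax corner of \<open>g S\<close>, and hence uniform extension leaves \<open>k \<ge> 1\<close> admissible symbols for \<open>a\<close>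
  whatever the rest of the window shows. So locally valid patterns extend to arbitrarily large
  finite sets. The group may be uncountable, so instead of exhausting it by a sequence one applies
  Tychonoff's theorem (\<open>finite_alphabet_compactness\<close>) to pass to the whole group.

  Locally valid patterns on \<open>C\<close> with prescribed contour are counted by filling the other points in
  increasing order (\<open>card_patterns_with_valid_windows\<close>). Since \<open>1\<close> is the maximum of \<open>S\<close> and the
  order is left-invariant, \<open>g\<close> is the maximum of \<open>g S\<close>. The non-contour points \<open>g\<close> of \<open>C\<close> are thus
  in bijection with the translates inside \<open>C\<close>, and the constraint on \<open>g S\<close> becomes complete exactly
  when \<open>g\<close> is filled, by one of exactly \<open>k\<close> symbols.
\<close>

section \<open>Compactness for finite alphabets\<close>

text \<open>
  The constraint is a finite union of cylinders, one for each admissible pattern on \<open>F\<close>, and a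
  cylinder is a product of closed sets.
\<close>

lemma closedin_restriction_constraint:
  assumes "finite A" and "finite F" and "F \<subseteq> I"
  shows "closedin (product_topology (\<lambda>_. discrete_topology A) I)
           {x \<in> I \<rightarrow>\<^sub>E A. restrict x F \<in> Y}"
proof -
  define cyl where "cyl p = (\<Pi>\<^sub>E i\<in>I. if i \<in> F then {p i} else A)" for p
  have "closedin (product_topology (\<lambda>_. discrete_topology A) I) (cyl p)"
    if "p \<in> F \<rightarrow>\<^sub>E A" for p
    unfolding cyl_def closedin_product_topology using that by (auto simp: PiE_iff)
  moreover have "finite (F \<rightarrow>\<^sub>E A)"
    using assms by (simp add: finite_PiE)
  ultimately have "closedin (product_topology (\<lambda>_. discrete_topology A) I)
      (\<Union>p\<in>(F \<rightarrow>\<^sub>E A) \<inter> Y. cyl p)"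
    by (intro closedin_Union) auto
  also have "(\<Union>p\<in>(F \<rightarrow>\<^sub>E A) \<inter> Y. cyl p) = {x \<in> I \<rightarrow>\<^sub>E A. restrict x F \<in> Y}"
  proof (intro equalityI subsetI)
    fix x assume "x \<in> (\<Union>p\<in>(F \<rightarrow>\<^sub>E A) \<inter> Y. cyl p)"
    then obtain p where p: "p \<in> F \<rightarrow>\<^sub>E A" "p \<in> Y" "x \<in> cyl p" by blast
    have mem: "x i \<in> (if i \<in> F then {p i} else A)" if "i \<in> I" for i
      using p(3) that unfolding cyl_def by (rule PiE_mem)
    have xF: "x i = p i" if "i \<in> F" for i
      using mem[of i] that assms(3) by auto
    then have "restrict x F = restrict p F" by (intro restrict_ext)
    then have "restrict x F = p" using p(1) by simp
    moreover have "x \<in> I \<rightarrow>\<^sub>E A"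
    proof (rule PiE_I)
      show "x i \<in> A" if "i \<in> I" for i
        using mem[OF that] p(1) by (auto split: if_splits)
      show "x i = undefined" if "i \<notin> I" for i
        using p(3) that unfolding cyl_def by (rule PiE_arb)
    qed
    ultimately show "x \<in> {x \<in> I \<rightarrow>\<^sub>E A. restrict x F \<in> Y}" using p(2) by simp
  next
    fix x assume x: "x \<in> {x \<in> I \<rightarrow>\<^sub>E A. restrict x F \<in> Y}"
    then have "restrict x F \<in> (F \<rightarrow>\<^sub>E A) \<inter> Y"
      using assms(3) by auto
    moreover have "x \<in> cyl (restrict x F)"
      using x by (auto simp: cyl_def PiE_iff)
    ultimately show "x \<in> (\<Union>p\<in>(F \<rightarrow>\<^sub>E A) \<inter> Y. cyl p)" by blast
  qed
  finally show ?thesis .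
qed

text \<open>
  By Tychonoff's theorem the full configuration space is compact, so the closed sets cut out by the
  individual constraints have a common point as soon as finitely many of them always do.
\<close>

lemma finite_alphabet_compactness:
  assumes "finite A"
    and fin: "\<And>j. j \<in> J \<Longrightarrow> finite (F j)" and sub: "\<And>j. j \<in> J \<Longrightarrow> F j \<subseteq> I"
    and sat: "\<And>J'. finite J' \<Longrightarrow> J' \<subseteq> J \<Longrightarrow> \<exists>x\<in>I \<rightarrow>\<^sub>E A. \<forall>j\<in>J'. restrict x (F j) \<in> Y j"
  shows "\<exists>x\<in>I \<rightarrow>\<^sub>E A. \<forall>j\<in>J. restrict x (F j) \<in> Y j"
proof -
  define X where "X = product_topology (\<lambda>_. discrete_topology A) I"
  define K where "K j = {x \<in> I \<rightarrow>\<^sub>E A. restrict x (F j) \<in> Y j}" for j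
  have top: "topspace X = I \<rightarrow>\<^sub>E A" by (simp add: X_def)
  have compact: "compact_space X"
    using assms(1) by (simp add: X_def compact_space_product_topology compact_space_discrete_topology)
  \<comment> \<open>The whole space joins the family so that for \<open>J = {}\<close> the intersection is still a set of
     configurations rather than the universe.\<close>
  have closed: "closedin X L" if L: "L \<in> insert (topspace X) (K ` J)" for L
  proof -
    consider "L = topspace X" | j where "j \<in> J" "L = K j" using L by blast
    then show ?thesis
    proof cases
      case 2
      then show ?thesis
        using closedin_restriction_constraint[OF assms(1) fin sub] by (simp add: X_def K_def)
    qed simp
  qed
  have fip: "\<Inter>\<F> \<noteq> {}" if "finite \<F>" "\<F> \<subseteq> insert (topspace X) (K ` J)" for \<F>
  proof -
    have "finite (\<F> - {topspace X})" "\<F> - {topspace X} \<subseteq> K ` J"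
      using that by (simp, blast)
    then obtain J' where J': "J' \<subseteq> J" "finite J'" "\<F> - {topspace X} = K ` J'"
      by (rule finite_subset_image[THEN exE]) blast
    obtain x where x: "x \<in> I \<rightarrow>\<^sub>E A" "\<forall>j\<in>J'. restrict x (F j) \<in> Y j"
      using sat[OF J'(2,1)] by (rule bexE)
    have "x \<in> L" if "L \<in> \<F>" for L
    proof (cases "L = topspace X")
      case True
      then show ?thesis using x(1) by (simp only: top)
    next
      case False
      then have "L \<in> K ` J'" using that J'(3)[symmetric] by simp
      then show ?thesis using x by (elim imageE) (simp add: K_def)
    qed
    then have "x \<in> \<Inter>\<F>" by (rule InterI)
    then show ?thesis by force
  qed
  have "\<Inter>(insert (topspace X) (K ` J)) \<noteq> {}"
    by (rule compact[unfolded compact_space_fip, rule_format]) (use closed fip in simp_all)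
  then obtain x where "x \<in> \<Inter>(insert (topspace X) (K ` J))"
    unfolding ex_in_conv[symmetric] by (rule exE)
  then have x: "x \<in> topspace X" "\<And>j. j \<in> J \<Longrightarrow> x \<in> K j" by simp_all
  show ?thesis
  proof (intro bexI ballI)
    show "x \<in> I \<rightarrow>\<^sub>E A" using x(1) by (simp only: top)
    show "restrict x (F j) \<in> Y j" if "j \<in> J" for j using x(2)[OF that] by (simp only: K_def mem_Collect_eq)
  qed
qed

section \<open>Windows and locally valid patterns\<close>

text \<open>
  The window at \<open>g\<close> is the pattern that a configuration shows on \<open>g S\<close>, transported back to \<open>S\<close>;
  it is the shape in which \<open>T\<close> is tested, with \<open>g\<close> in place of the inverse used by the shift.
\<close>

definition window :: "('g, 'm) monoid_scheme \<Rightarrow> 'g set \<Rightarrow> 'g \<Rightarrow> ('g \<Rightarrow> 'a) \<Rightarrow> 'g \<Rightarrow> 'a" where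
  "window G S g x = (\<lambda>s\<in>S. x (g \<otimes>\<^bsub>G\<^esub> s))"

definition locally_valid ::
  "('g, 'm) monoid_scheme \<Rightarrow> 'g set \<Rightarrow> ('g \<Rightarrow> 'a) set \<Rightarrow> 'g set \<Rightarrow> ('g \<Rightarrow> 'a) \<Rightarrow> bool" where
  "locally_valid G S T C Q \<longleftrightarrow>
    (\<forall>g\<in>carrier G. g <#\<^bsub>G\<^esub> S \<subseteq> C \<longrightarrow> window G S g Q \<in> T)"

lemma mem_l_coset_iff: "x \<in> g <#\<^bsub>G\<^esub> S \<longleftrightarrow> (\<exists>s\<in>S. x = g \<otimes>\<^bsub>G\<^esub> s)"
  by (auto simp: l_coset_def)

lemma l_coset_subset_iff: "g <#\<^bsub>G\<^esub> S \<subseteq> C \<longleftrightarrow> (\<forall>s\<in>S. g \<otimes>\<^bsub>G\<^esub> s \<in> C)"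
  by (auto simp: l_coset_def)

lemma window_cong:
  assumes "\<And>s. s \<in> S \<Longrightarrow> x (g \<otimes>\<^bsub>G\<^esub> s) = y (g \<otimes>\<^bsub>G\<^esub> s)"
  shows "window G S g x = window G S g y"
  using assms unfolding window_def by (intro restrict_ext) auto

lemma window_fun_upd_other:
  assumes "a \<notin> g <#\<^bsub>G\<^esub> S"
  shows "window G S g (x(a := v)) = window G S g x"
  using assms by (intro window_cong) (auto simp: mem_l_coset_iff)

lemma window_restrict:
  assumes "g <#\<^bsub>G\<^esub> S \<subseteq> C"
  shows "window G S g (restrict x C) = window G S g x"
  using assms by (intro window_cong) (auto simp: l_coset_subset_iff)

lemma restrict_fun_upd_outside:
  assumes "Q \<in> D \<rightarrow>\<^sub>E A" and "m \<notin> D"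
  shows "restrict (Q(m := v)) D = Q"
proof -
  have "restrict (Q(m := v)) D = restrict Q D" using assms(2) by (intro restrict_ext) auto
  then show ?thesis using assms(1) by simp
qed

lemma fun_upd_restrict_inside:
  assumes "Q \<in> insert m D \<rightarrow>\<^sub>E A"
  shows "(restrict Q D)(m := Q m) = Q"
proof
  fix h
  show "((restrict Q D)(m := Q m)) h = Q h"
    using PiE_arb[OF assms, of h] by (cases "h \<in> D") auto
qed

lemma convexoid_member:
  assumes "convexoid V \<C>" and "C \<in> \<C>"
  shows "finite C" and "C \<subseteq> V"
  using assms by (simp_all add: convexoid_def)

lemma convexoid_cover:
  assumes "convexoid V \<C>" and "finite F" and "F \<subseteq> V"
  obtains C where "C \<in> \<C>" and "F \<subseteq> C"
  using assms by (auto simp: convexoid_def)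

context group
begin

text \<open>As \<open>g\<close> ranges over the group, so does its inverse, which removes the inversion in the shift.\<close>

lemma subshift_iff_windows:
  assumes "S \<subseteq> carrier G"
  shows "x \<in> subshift G A S T \<longleftrightarrow>
    x \<in> carrier G \<rightarrow>\<^sub>E A \<and> (\<forall>g\<in>carrier G. window G S g x \<in> T)"
proof -
  have "restrict (shift_action G g x) S = window G S (inv g) x" if "g \<in> carrier G" for g
    using assms unfolding window_def shift_action_def by (intro restrict_ext) auto
  then have "(\<forall>g\<in>carrier G. restrict (shift_action G g x) S \<in> T) \<longleftrightarrow>
      (\<forall>g\<in>carrier G. window G S (inv g) x \<in> T)"
    by simp
  also have "\<dots> \<longleftrightarrow> (\<forall>g\<in>carrier G. window G S g x \<in> T)"
    by (metis inv_closed inv_inv)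
  finally show ?thesis unfolding subshift_def by blast
qed

text \<open>
  Uniform extension at \<open>s\<close>, transported from \<open>S\<close> to \<open>g S\<close>: left multiplication is injective, so
  changing \<open>Q\<close> at \<open>g s\<close> changes its window at \<open>s\<close> only.
\<close>

lemma card_symbols_completing_window:
  assumes "S \<subseteq> carrier G" and "g \<in> carrier G"
    and "uniform_extensions A S T k E'" and "s \<in> E'"
    and "\<And>t. t \<in> S \<Longrightarrow> t \<noteq> s \<Longrightarrow> Q (g \<otimes> t) \<in> A"
  shows "card {v \<in> A. window G S g (Q(g \<otimes> s := v)) \<in> T} = k"
proof -
  let ?P = "\<lambda>t\<in>S - {s}. Q (g \<otimes> t)"
  have "s \<in> S" using assms(3,4) unfolding uniform_extensions_def by blast
  have "?P \<in> (S - {s}) \<rightarrow>\<^sub>E A" using assms(5) by auto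
  then have "card {v \<in> A. ?P(s := v) \<in> T} = k"
    using assms(3,4) unfolding uniform_extensions_def by blast
  moreover have "window G S g (Q(g \<otimes> s := v)) = ?P(s := v)" for v
    using \<open>s \<in> S\<close> assms(1,2) unfolding window_def by (intro ext) (auto simp: subset_iff)
  ultimately show ?thesis by simp
qed

section \<open>Extending locally valid patterns\<close>

text \<open>
  The new point \<open>a\<close> is a lax corner of \<open>insert a C\<close>, so at most one translate \<open>g S\<close> through \<open>a\<close>
  lies in \<open>insert a C\<close>. Only its constraint is new, and \<open>a\<close> is a corner of \<open>g S\<close>, where the symbol
  can always be completed.
\<close>

lemma extend_locally_valid_by_one:
  assumes S: "S \<subseteq> carrier G" and ucp: "S_UCP G S \<C>"
    and A: "A \<noteq> {}" and k: "k \<ge> 1" and tep: "TEP G \<C> A S T k"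
    and C: "C \<in> \<C>" and aC: "insert a C \<in> \<C>" and a: "a \<notin> C"
    and Q: "Q \<in> C \<rightarrow>\<^sub>E A" and valid: "locally_valid G S T C Q"
  shows "\<exists>v\<in>A. locally_valid G S T (insert a C) (Q(a := v))"
proof -
  have "insert a C - {a} = C" using a by blast
  \<comment> \<open>\<open>C\<close> itself belongs to the family and omits \<open>a\<close>, so the hull of \<open>C\<close> does too.\<close>
  then have "a \<in> lax_corners \<C> (insert a C)"
    using C a unfolding lax_corners_def convexoid_closure_def by auto
  then have uniq: "\<exists>\<^sub>\<le>\<^sub>1 g. g \<in> carrier G \<and> a \<in> g <# S \<and> g <# S \<subseteq> insert a C"
    using ucp aC unfolding S_UCP_def by blast
  have reduce: "locally_valid G S T (insert a C) (Q(a := v))"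
    if "\<And>g. g \<in> carrier G \<Longrightarrow> a \<in> g <# S \<Longrightarrow> g <# S \<subseteq> insert a C \<Longrightarrow>
          window G S g (Q(a := v)) \<in> T" for v
    unfolding locally_valid_def
  proof (intro ballI impI)
    fix g assume g: "g \<in> carrier G" "g <# S \<subseteq> insert a C"
    show "window G S g (Q(a := v)) \<in> T"
    proof (cases "a \<in> g <# S")
      case False
      then show ?thesis
        using g valid unfolding locally_valid_def by (auto simp: window_fun_upd_other)
    qed (use g that in blast)
  qed
  show ?thesis
  proof (cases "\<exists>g. g \<in> carrier G \<and> a \<in> g <# S \<and> g <# S \<subseteq> insert a C")
    case False
    then show ?thesis using reduce A by blast
  next
    case True
    then obtain g where g: "g \<in> carrier G" "a \<in> g <# S" "g <# S \<subseteq> insert a C" by blast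
    then obtain s where s: "s \<in> S" "a = g \<otimes> s" by (auto simp: mem_l_coset_iff)
    let ?E = "inv g <# lax_corners \<C> (g <# S)"
    \<comment> \<open>\<open>C\<close> also witnesses that the hull of \<open>g S\<close> without \<open>a\<close> omits \<open>a\<close>.\<close>
    have "(g <# S) - {a} \<subseteq> C" using g(3) by blast
    then have "a \<in> lax_corners \<C> (g <# S)"
      using C a g(2) unfolding lax_corners_def convexoid_closure_def by blast
    moreover have "s = inv g \<otimes> a" using g(1) s S by (auto simp: m_assoc[symmetric])
    ultimately have "s \<in> ?E" unfolding mem_l_coset_iff by blast
    moreover have "uniform_extensions A S T k ?E"
      using tep g(1) unfolding TEP_def by blast
    moreover have "Q (g \<otimes> t) \<in> A" if "t \<in> S" "t \<noteq> s" for t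
    proof -
      have "g \<otimes> t \<noteq> a" using that s S g(1) by (auto simp: subset_iff)
      then have "g \<otimes> t \<in> C" using g(3) that by (auto simp: l_coset_subset_iff)
      then show ?thesis using Q by blast
    qed
    ultimately have "card {v \<in> A. window G S g (Q(a := v)) \<in> T} = k"
      using card_symbols_completing_window[OF S g(1), of A T k ?E s Q] s(2) by simp
    then have "{v \<in> A. window G S g (Q(a := v)) \<in> T} \<noteq> {}"
      using k by (metis card.empty not_one_le_zero)
    then obtain v where "v \<in> A" "window G S g (Q(a := v)) \<in> T" by blast
    moreover have "g' = g" if "g' \<in> carrier G" "a \<in> g' <# S" "g' <# S \<subseteq> insert a C" for g'
      using uniq that g by (auto dest: Uniq_D)
    ultimately show ?thesis using reduce by blast
  qed
qed

lemma extend_locally_valid: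
  assumes S: "S \<subseteq> carrier G" and conv: "convexoid (carrier G) \<C>" and ucp: "S_UCP G S \<C>"
    and A: "A \<noteq> {}" and k: "k \<ge> 1" and tep: "TEP G \<C> A S T k"
    and "C \<in> \<C>" and D: "D \<in> \<C>" and "C \<subseteq> D"
    and "Q \<in> C \<rightarrow>\<^sub>E A" and "locally_valid G S T C Q"
  shows "\<exists>R\<in>D \<rightarrow>\<^sub>E A. restrict R C = Q \<and> locally_valid G S T D R"
  using assms(7,9-11)
proof (induction "card (D - C)" arbitrary: C Q rule: less_induct)
  case less
  show ?case
  proof (cases "C = D")
    case True
    then show ?thesis using less.prems by (auto intro!: bexI[of _ Q])
  next
    case False
    then obtain a where a: "a \<in> D - C" "insert a C \<in> \<C>"
      using conv less.prems(1,2) D unfolding convexoid_def by (metis Un_insert_right psubsetI sup_bot_right)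
    obtain v where v: "v \<in> A" "locally_valid G S T (insert a C) (Q(a := v))"
      using extend_locally_valid_by_one[OF S ucp A k tep less.prems(1) a(2)] a(1) less.prems
      by blast
    have "finite D" using convexoid_member(1)[OF conv D] .
    then have "card (D - insert a C) < card (D - C)"
      using a(1) by (intro psubset_card_mono) auto
    moreover have "Q(a := v) \<in> insert a C \<rightarrow>\<^sub>E A"
      using v(1) less.prems(3) by (intro PiE_fun_upd) auto
    ultimately obtain R where R: "R \<in> D \<rightarrow>\<^sub>E A" "restrict R (insert a C) = Q(a := v)"
        "locally_valid G S T D R"
      using less.hyps[of "insert a C" "Q(a := v)"] a less.prems(2) v(2) by blast
    have "R h = Q h" if "h \<in> C" for h
      using fun_cong[OF R(2), of h] a(1) that by (auto split: if_splits)
    then have "restrict R C = restrict Q C" by (intro restrict_ext)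
    then have "restrict R C = Q" using less.prems(3) by simp
    then show ?thesis using R by blast
  qed
qed

text \<open>
  The finitely many constraints considered at once in the compactness argument involve only points of
  some member \<open>D\<close> of the family containing \<open>C\<close>; a locally valid extension of \<open>Q\<close> to \<open>D\<close>, continued
  arbitrarily outside \<open>D\<close>, satisfies them.
\<close>

lemma locally_valid_iff_extends_to_subshift:
  assumes S: "S \<subseteq> carrier G" "finite S" and conv: "convexoid (carrier G) \<C>"
    and ucp: "S_UCP G S \<C>" and A: "finite A" "A \<noteq> {}" and k: "k \<ge> 1"
    and tep: "TEP G \<C> A S T k" and C: "C \<in> \<C>" and Q: "Q \<in> C \<rightarrow>\<^sub>E A"
  shows "(\<exists>x\<in>subshift G A S T. Q = restrict x C) \<longleftrightarrow> locally_valid G S T C Q"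
proof
  assume "\<exists>x\<in>subshift G A S T. Q = restrict x C"
  then obtain x where "x \<in> subshift G A S T" "Q = restrict x C" by blast
  then show "locally_valid G S T C Q"
    by (simp add: locally_valid_def subshift_iff_windows[OF S(1)] window_restrict)
next
  assume valid: "locally_valid G S T C Q"
  have finC: "finite C" "C \<subseteq> carrier G" using convexoid_member[OF conv C] .
  have gS: "finite (g <# S)" "g <# S \<subseteq> carrier G" if "g \<in> carrier G" for g
    using S that by (auto simp: l_coset_def)
  \<comment> \<open>\<open>None\<close> stands for the constraint of agreeing with \<open>Q\<close> on \<open>C\<close>,
     \<open>Some g\<close> for the constraint that the window at \<open>g\<close> lies in \<open>T\<close>.\<close>
  define F where "F j = (case j of None \<Rightarrow> C | Some g \<Rightarrow> g <# S)" for j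
  define Y where "Y j = (case j of None \<Rightarrow> {Q} | Some g \<Rightarrow> {p. window G S g p \<in> T})" for j
  define J where "J = insert None (Some ` carrier G)"
  have finF: "finite (F j)" "F j \<subseteq> carrier G" if "j \<in> J" for j
    using that finC gS unfolding J_def F_def by (cases j; simp add: image_iff)+
  have "\<exists>x\<in>carrier G \<rightarrow>\<^sub>E A. \<forall>j\<in>J. restrict x (F j) \<in> Y j"
  proof (rule finite_alphabet_compactness[OF A(1)])
    show "finite (F j)" "F j \<subseteq> carrier G" if "j \<in> J" for j
      using finF[OF that] .
  next
    fix J' assume J': "finite J'" "J' \<subseteq> J"
    have "finite (C \<union> (\<Union>j\<in>J'. F j))" "C \<union> (\<Union>j\<in>J'. F j) \<subseteq> carrier G"
      using J' finC finF by blast+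
    then obtain D where D: "D \<in> \<C>" "C \<union> (\<Union>j\<in>J'. F j) \<subseteq> D"
      by (rule convexoid_cover[OF conv])
    then obtain R where R: "R \<in> D \<rightarrow>\<^sub>E A" "restrict R C = Q" "locally_valid G S T D R"
      using extend_locally_valid[OF S(1) conv ucp A(2) k tep C D(1) _ Q valid] D(2) by blast
    obtain d where d: "d \<in> A" using A(2) by blast
    let ?x = "\<lambda>h\<in>carrier G. if h \<in> D then R h else d"
    have DG: "D \<subseteq> carrier G" using convexoid_member(2)[OF conv D(1)] .
    have "?x \<in> carrier G \<rightarrow>\<^sub>E A" using R(1) d by auto
    moreover have "restrict ?x (F j) \<in> Y j" if j: "j \<in> J'" for j
    proof (cases j)
      case None
      have "restrict ?x C = restrict R C"
        using D(2) DG by (intro restrict_ext) auto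
      then show ?thesis using None R(2) by (simp add: F_def Y_def)
    next
      case (Some g)
      have "F j \<subseteq> D" using j D(2) by blast
      then have g: "g \<in> carrier G" "g <# S \<subseteq> D"
        using Some j J'(2) by (auto simp: J_def F_def)
      have "window G S g ?x = window G S g R"
        using g DG by (intro window_cong) (auto simp: l_coset_subset_iff)
      then show ?thesis
        using Some g R(3) window_restrict[of G g S "g <# S" ?x]
        by (simp add: F_def Y_def locally_valid_def del: restrict_restrict)
    qed
    ultimately show "\<exists>x\<in>carrier G \<rightarrow>\<^sub>E A. \<forall>j\<in>J'. restrict x (F j) \<in> Y j" by blast
  qed
  then obtain x where x: "x \<in> carrier G \<rightarrow>\<^sub>E A" "\<forall>j\<in>J. restrict x (F j) \<in> Y j" by blast
  have "None \<in> J" by (simp add: J_def)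
  then have "restrict x (F None) \<in> Y None" using x(2) by blast
  then have "Q = restrict x C" by (simp add: F_def Y_def)
  moreover have "window G S g x \<in> T" if "g \<in> carrier G" for g
  proof -
    have "Some g \<in> J" using that by (simp add: J_def)
    then have "restrict x (F (Some g)) \<in> Y (Some g)" using x(2) by blast
    then show ?thesis by (simp add: F_def Y_def window_restrict)
  qed
  then have "x \<in> subshift G A S T"
    using x(1) by (simp add: subshift_iff_windows[OF S(1)])
  ultimately show "\<exists>x\<in>subshift G A S T. Q = restrict x C" by (rule bexI)
qed

section \<open>Counting by filling in increasing order\<close>

text \<open>
  Induction on \<open>B\<close>, removing a maximal element \<open>m\<close>. No other translate \<open>g S\<close> with \<open>g \<in> B\<close> contains
  \<open>m\<close>, as its elements other than \<open>g\<close> lie below \<open>g\<close>. So the remaining points satisfy the same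
  hypotheses, and the only condition on the symbol at \<open>m\<close> is the one in the window at \<open>m\<close>, where it
  sits at position \<open>1\<close>; it has exactly \<open>k\<close> solutions.
\<close>

lemma card_patterns_with_valid_windows:
  assumes tr: "trans r" and irr: "irrefl r" and inv: "left_invariant G r"
    and S: "S \<subseteq> carrier G" and pos: "good_position G r S" and A: "finite A"
    and unif: "uniform_extensions A S T k {\<one>}"
    and E: "finite E" and P: "P \<in> E \<rightarrow>\<^sub>E A"
    and "finite B" and "B \<subseteq> carrier G" and "E \<inter> B = {}"
    and "\<And>g. g \<in> B \<Longrightarrow> g <# S \<subseteq> E \<union> B"
  shows "card {Q \<in> (E \<union> B) \<rightarrow>\<^sub>E A. restrict Q E = P \<and> (\<forall>g\<in>B. window G S g Q \<in> T)} = k ^ card B"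
  using assms(10-13)
proof (induction "card B" arbitrary: B)
  case 0
  then have [simp]: "B = {}" by simp
  have "{Q \<in> (E \<union> B) \<rightarrow>\<^sub>E A. restrict Q E = P \<and> (\<forall>g\<in>B. window G S g Q \<in> T)} = {P}"
    using P by auto
  then show ?case by (simp only:) simp
next
  case (Suc n)
  note sub = Suc.prems(4)
  have below: "(g \<otimes> s, g) \<in> r" if "g \<in> carrier G" "s \<in> S" "s \<noteq> \<one>" for g s
    using inv pos that S unfolding left_invariant_def good_position_def
    by (metis one_closed r_one subsetD)
  obtain m where m: "m \<in> B" "\<And>g. g \<in> B \<Longrightarrow> (m, g) \<notin> r"
  proof -
    have "acyclic r"
      using tr irr by (simp add: acyclic_irrefl)
    then have "acyclic (r \<inter> B \<times> B)" by (rule acyclic_subset) blast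
    then have "wf ((r \<inter> B \<times> B)\<inverse>)"
      using Suc.prems(1) by (intro finite_acyclic_wf_converse) auto
    moreover have "B \<noteq> {}" using Suc.hyps(2) by auto
    ultimately obtain m where "m \<in> B" "\<And>g. (g, m) \<in> (r \<inter> B \<times> B)\<inverse> \<Longrightarrow> g \<notin> B"
      by (metis (no_types, lifting) wfE_min ex_in_conv)
    then show ?thesis using that by blast
  qed
  define B' where "B' = B - {m}"
  have B: "B = insert m B'" "m \<notin> B'" "m \<notin> E" using m(1) Suc.prems(3) by (auto simp: B'_def)
  have mG: "m \<in> carrier G" using m(1) Suc.prems(2) by blast
  have m_notin: "m \<notin> g <# S" if "g \<in> B'" for g
  proof
    assume "m \<in> g <# S"
    then obtain s where s: "s \<in> S" "m = g \<otimes> s" by (auto simp: mem_l_coset_iff)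
    have g: "g \<in> B" "g \<in> carrier G" "g \<noteq> m" using that Suc.prems(2) by (auto simp: B'_def)
    then have "s \<noteq> \<one>" using s by auto
    then have "(m, g) \<in> r" using below g s by blast
    then show False using m(2) g by blast
  qed
  let ?V = "\<lambda>B. {Q \<in> (E \<union> B) \<rightarrow>\<^sub>E A. restrict Q E = P \<and> (\<forall>g\<in>B. window G S g Q \<in> T)}"
  let ?W = "\<lambda>Q. {v \<in> A. window G S m (Q(m := v)) \<in> T}"
  have cardB': "card B = Suc (card B')" "n = card B'"
    using B Suc.prems(1) Suc.hyps(2) by auto
  have IH: "card (?V B') = k ^ card B'"
  proof (rule Suc.hyps(1))
    show "g <# S \<subseteq> E \<union> B'" if "g \<in> B'" for g
      using sub[of g] that m_notin[OF that] B by blast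
  qed (use Suc.prems cardB' in \<open>auto simp: B'_def\<close>)
  have cardW: "card (?W Q) = k" if "Q \<in> ?V B'" for Q
  proof -
    have "Q (m \<otimes> t) \<in> A" if "t \<in> S" "t \<noteq> \<one>" for t
    proof -
      have "m \<otimes> t \<in> E \<union> B" using sub[OF m(1)] that by (auto simp: l_coset_subset_iff)
      moreover have "m \<otimes> t \<noteq> m" using below[OF mG that] irr by (auto simp: irrefl_def)
      ultimately have "m \<otimes> t \<in> E \<union> B'" using B by blast
      then show ?thesis using \<open>Q \<in> ?V B'\<close> by blast
    qed
    then show ?thesis
      using card_symbols_completing_window[OF S mG unif, of \<one> Q] mG by simp
  qed
  \<comment> \<open>A pattern on \<open>E \<union> B\<close> is a pattern on \<open>E \<union> B'\<close> together with a symbol at \<open>m\<close>.\<close>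
  have "bij_betw (\<lambda>(Q, v). Q(m := v)) (SIGMA Q:?V B'. ?W Q) (?V B)"
  proof (rule bij_betw_byWitness[where f' = "\<lambda>Q. (restrict Q (E \<union> B'), Q m)"])
    show "\<forall>p\<in>SIGMA Q:?V B'. ?W Q. (\<lambda>Q. (restrict Q (E \<union> B'), Q m)) ((\<lambda>(Q, v). Q(m := v)) p) = p"
    proof
      fix p assume p: "p \<in> (SIGMA Q:?V B'. ?W Q)"
      obtain Q v where [simp]: "p = (Q, v)" by (cases p)
      have "Q \<in> (E \<union> B') \<rightarrow>\<^sub>E A" using p by simp
      then have "restrict (Q(m := v)) (E \<union> B') = Q"
        using B by (intro restrict_fun_upd_outside) auto
      then show "(\<lambda>Q. (restrict Q (E \<union> B'), Q m)) ((\<lambda>(Q, v). Q(m := v)) p) = p" by simp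
    qed
  next
    have restore: "(restrict Q (E \<union> B'))(m := Q m) = Q" if "Q \<in> ?V B" for Q
    proof (rule fun_upd_restrict_inside)
      show "Q \<in> insert m (E \<union> B') \<rightarrow>\<^sub>E A" using that B(1) by simp
    qed
    then show "\<forall>Q\<in>?V B. (\<lambda>(Q, v). Q(m := v)) (restrict Q (E \<union> B'), Q m) = Q" by simp
    show "(\<lambda>Q. (restrict Q (E \<union> B'), Q m)) ` ?V B \<subseteq> (SIGMA Q:?V B'. ?W Q)"
    proof (rule image_subsetI)
      fix Q assume Q: "Q \<in> ?V B"
      have "window G S g (restrict Q (E \<union> B')) \<in> T" if "g \<in> B'" for g
      proof -
        have "g <# S \<subseteq> E \<union> B'" using sub[of g] m_notin[OF that] that B by blast
        moreover have "window G S g Q \<in> T" using Q that B(1) by blast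
        ultimately show ?thesis by (simp add: window_restrict)
      qed
      moreover have "restrict Q (E \<union> B') \<in> (E \<union> B') \<rightarrow>\<^sub>E A" using Q B by auto
      moreover have "restrict (restrict Q (E \<union> B')) E = P"
      proof -
        have "restrict (restrict Q (E \<union> B')) E = restrict Q E" by (intro restrict_ext) simp
        then show ?thesis using Q by blast
      qed
      ultimately have "restrict Q (E \<union> B') \<in> ?V B'" by blast
      moreover have "Q m \<in> ?W (restrict Q (E \<union> B'))"
      proof -
        have "Q m \<in> A" "window G S m Q \<in> T" using Q m(1) by blast+
        then show ?thesis by (simp only: restore[OF Q] mem_Collect_eq)
      qed
      ultimately show "(restrict Q (E \<union> B'), Q m) \<in> (SIGMA Q:?V B'. ?W Q)" by blast
    qed
    show "(\<lambda>(Q, v). Q(m := v)) ` (SIGMA Q:?V B'. ?W Q) \<subseteq> ?V B"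
    proof (rule image_subsetI)
      fix p assume p: "p \<in> (SIGMA Q:?V B'. ?W Q)"
      obtain Q v where [simp]: "p = (Q, v)" by (cases p)
      have Q: "Q \<in> (E \<union> B') \<rightarrow>\<^sub>E A" "restrict Q E = P" "\<forall>g\<in>B'. window G S g Q \<in> T"
        and v: "v \<in> A" "window G S m (Q(m := v)) \<in> T"
        using p by simp_all
      have "Q(m := v) \<in> (E \<union> B) \<rightarrow>\<^sub>E A"
        using PiE_fun_upd[of v "\<lambda>_. A" m Q "E \<union> B'"] Q(1) v(1) B(1) by simp
      moreover have "restrict (Q(m := v)) E = restrict Q E"
        using B(3) by (intro restrict_ext) auto
      moreover have "window G S g (Q(m := v)) \<in> T" if "g \<in> B" for g
        using that B(1) v(2) Q(3) m_notin by (cases "g = m") (simp_all add: window_fun_upd_other)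
      ultimately show "(\<lambda>(Q, v). Q(m := v)) p \<in> ?V B" using Q(2) by simp
    qed
  qed
  then have "card (?V B) = card (SIGMA Q:?V B'. ?W Q)"
    by (rule bij_betw_same_card[symmetric])
  also have "\<dots> = (\<Sum>Q\<in>?V B'. card (?W Q))"
  proof (rule card_SigmaI)
    have "finite B'" using Suc.prems(1) by (simp add: B'_def)
    then show "finite (?V B')" using E A by (simp add: finite_PiE)
  qed (use A in auto)
  also have "\<dots> = card (?V B') * k" using cardW by simp
  finally show ?case using IH cardB' by simp
qed

end

section \<open>Patterns with prescribed contour\<close>

theorem theorem29:
  fixes G :: "('g, 'm) monoid_scheme"
    and r :: "'g rel"
    and S C :: "'g set"
    and \<C> :: "'g set set"
    and A :: "'a set"
    and T :: "('g \<Rightarrow> 'a) set"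
    and k :: nat
  assumes "group G"
    and "strict_linear_order_on (carrier G) r"
    and "left_invariant G r"
    and "finite S" and "S \<subseteq> carrier G"
    and "good_position G r S"
    and "convexoid (carrier G) \<C>"
    and "S_UCP G S \<C>"
    and "finite A" and "A \<noteq> {}"
    and "k \<ge> 1"
    and "T \<subseteq> S \<rightarrow>\<^sub>E A"
    and "TEP G \<C> A S T k"
    and "uniform_extensions A S T k {\<one>\<^bsub>G\<^esub>}"
    and "C \<in> \<C>"
  shows "\<forall>P \<in> contour G S C \<rightarrow>\<^sub>E A.
    card {Q \<in> C \<rightarrow>\<^sub>E A. restrict Q (contour G S C) = P \<and>
                      (\<exists>x\<in>subshift G A S T. Q = restrict x C)}
      = k ^ (card C - card (contour G S C))"
proof
  interpret group G by fact
  let ?E = "contour G S C"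
  fix P assume P: "P \<in> ?E \<rightarrow>\<^sub>E A"
  have finC: "finite C" and CG: "C \<subseteq> carrier G"
    using convexoid_member[OF assms(7,15)] .
  have EC: "?E \<subseteq> C" and inner: "\<And>g. g \<in> C - ?E \<Longrightarrow> g <#\<^bsub>G\<^esub> S \<subseteq> C"
    unfolding contour_def by auto
  have E: "?E \<union> (C - ?E) = C" using EC by blast
  have finE: "finite ?E" using EC finC by (rule finite_subset)
  \<comment> \<open>As \<open>1 \<in> S\<close>, the translates inside \<open>C\<close> are exactly those at the non-contour points.\<close>
  have "g \<in> C" if "g \<in> carrier G" "g <#\<^bsub>G\<^esub> S \<subseteq> C" for g
  proof -
    have "\<one>\<^bsub>G\<^esub> \<in> S" using assms(6) unfolding good_position_def by blast
    then show ?thesis using that by (metis l_coset_subset_iff r_one)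
  qed
  then have "g \<in> carrier G \<and> g <#\<^bsub>G\<^esub> S \<subseteq> C \<longleftrightarrow> g \<in> C - ?E" for g
    using CG unfolding contour_def by blast
  then have valid_iff: "locally_valid G S T C Q \<longleftrightarrow> (\<forall>g\<in>C - ?E. window G S g Q \<in> T)"
    for Q :: "'g \<Rightarrow> 'a"
    unfolding locally_valid_def by blast
  have "(\<exists>x\<in>subshift G A S T. Q = restrict x C) \<longleftrightarrow> (\<forall>g\<in>C - ?E. window G S g Q \<in> T)"
    if "Q \<in> C \<rightarrow>\<^sub>E A" for Q
    unfolding valid_iff[symmetric]
    by (rule locally_valid_iff_extends_to_subshift[OF assms(5,4,7-11,13,15) that])
  then have "{Q \<in> C \<rightarrow>\<^sub>E A. restrict Q ?E = P \<and> (\<exists>x\<in>subshift G A S T. Q = restrict x C)}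
      = {Q \<in> C \<rightarrow>\<^sub>E A. restrict Q ?E = P \<and> (\<forall>g\<in>C - ?E. window G S g Q \<in> T)}"
    by (intro Collect_cong conj_cong refl)
  also have "card \<dots> = k ^ card (C - ?E)"
  proof -
    have "finite (C - ?E)" "C - ?E \<subseteq> carrier G" "?E \<inter> (C - ?E) = {}"
      using finC CG by blast+
    moreover have "trans r" "irrefl r"
      using assms(2) unfolding strict_linear_order_on_def by blast+
    ultimately show ?thesis
      using card_patterns_with_valid_windows[OF _ _ assms(3,5,6,9,14) finE P, of "C - ?E"] inner
      unfolding E by blast
  qed
  also have "card (C - ?E) = card C - card ?E"
    using finE EC by (rule card_Diff_subset)
  finally show "card {Q \<in> C \<rightarrow>\<^sub>E A. restrict Q ?E = P \<and>
      (\<exists>x\<in>subshift G A S T. Q = restrict x C)} = k ^ (card C - card ?E)" .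
qed

end
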